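(* Fix $\beta\in(0,1)$ and choose $\beta_i>0$, $i\in\mathcal N$, such that $\sum_{i\in\mathcal N}\beta_i=\beta$. For each $i\in\mathcal N$ set $$\epsilon_i(s)=1-\left(\frac{\beta_i}{(N+1)\binom{K_i}{s}}\right)^{\frac{1}{K_i-s}}\quad (0\le s<K_i),\qquad \epsilon_i(K_i)=1 .$$ Let $\boldsymbol x^\ast$ be the unique allocation in $C(G_K)$ minimising a given convex function $f:\mathbb R^N\to\mathbb R$ over $C(G_K)$, and let $s_{i,K}$ be the cardinality, quantified a posteriori (i.e. depending on the observed multi-sample), of the part belonging to agent $i$ of a compression set for $\boldsymbol x^\ast$. Then $$\mathbb P^K\Bigl\{\boldsymbol\xi\in\Xi^K:\ \mathbb P\bigl\{\xi\in\Xi:\ \exists\,S\subset\mathcal N,\ \textstyle\sum_{i\in S}x_i^\ast<u_S(\xi)\bigr\}\le\sum_{i\in\mathcal N}\epsilon_i(s_{i,K})\Bigr\}\ \ge\ 1-\beta .$$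
   Context: Setting. $\mathcal N=\{1,\dots,N\}$ is the set of agents. $\Xi$ is the uncertainty set, endowed with an (unknown) probability measure $\mathbb P$. For every nonempty coalition $S\subset\mathcal N$ (throughout, $\subset$ between coalitions and $\mathcal N$ denotes proper inclusion, so $S\neq\mathcal N$) there is a value function $u_S:\Xi\to\mathbb R$; the value of the grand coalition is a deterministic number $u_{\mathcal N}\in\mathbb R$. An allocation is a vector $\boldsymbol x=(x_i)_{i\in\mathcal N}\in\mathbb R^N$. Private sampling. Each agent $i$ draws $\boldsymbol\xi_i=(\xi_i^{(1)},\dots,\xi_i^{(K_i)})\in\Xi^{K_i}$, consisting of $K_i$ independent samples from $\mathbb P$; samples of different agents are independent. Put $K=\sum_{i\in\mathcal N}K_i$; $\boldsymbol\xi=(\boldsymbol\xi_i)_{i\in\mathcal N}$ has law $\mathbb P^K$ (the $K$-fold product measure) on $\Xi^K$. Scenario core with private sampling: $$C(G_K)=\Bigl\{\boldsymbol x\in\mathbb R^N:\ \sum_{i\in\mathcal N}x_i=u_{\mathcal N}\ \text{ and }\ \sum_{i\in S}x_i\ge\max_{i\in S}\max_{k=1,\dots,K_i}u_S(\xi_i^{(k)})\ \ \forall S\subset\mathcal N\Bigr\}.$$ Standing assumption: $C(G_K)$ is nonempty for every $\boldsymbol\xi\in\Xi^K$. Uniqueness of the minimiser: $\boldsymbol x^\ast=\arg\min_{\boldsymbol x\in C(G_K)}f(\boldsymbol x)$ is unique; if several minimisers are possible, a convex tie-break rule is applied to single out one. Compression set for $\boldsymbol x^\ast$. A subset $I$ of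 the samples in $\boldsymbol\xi$ (each sample keeping its label $(i,k)$, i.e. the agent to which it belongs) is a compression set if, with $\mathbb P^K$-probability one with respect to the choice of $\boldsymbol\xi$, using only the samples in $I$ yields the same output as using all of $\boldsymbol\xi$; here this means that minimising $f$ (with the same tie-break rule) over $\{\boldsymbol x\in\mathbb R^N:\sum_{j\in\mathcal N}x_j=u_{\mathcal N},\ \sum_{j\in S}x_j\ge u_S(\xi_i^{(k)})\ \text{for all }\xi_i^{(k)}\in I\text{ and all }S\subset\mathcal N\text{ with }i\in S\}$ again returns $\boldsymbol x^\ast$. A compression set need not be of least cardinality (one of least cardinality is called minimal). It is quantified a posteriori, i.e. determined from the observed $\boldsymbol\xi$ by some procedure. The number $s_{i,K}$ is the cardinality of the (sub)compression set associated with the rationality constraints relative to all $S\subset\mathcal N$ with $i\in S$, i.e. the number of elements of $I$ that are samples of agent $i$. *)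

theory Defs
  imports "HOL-Probability.Probability"
begin

text \<open>
  The agents are the elements of a finite type \<open>'n\<close>, so \<open>N = CARD('n)\<close>, the grand coalition
  is \<open>UNIV\<close>, and allocations are vectors in \<open>real ^ 'n\<close>.  The uncertainty set is the space of a
  measure \<open>M\<close>.  A multi-sample is a function \<open>\<xi>\<close> on labels: \<open>\<xi> (i, k)\<close> is the \<open>k\<close>-th sample of
  agent \<open>i\<close>, for \<open>1 \<le> k \<le> K i\<close>.
\<close>

definition coalitions :: "'n::finite set set" where
  "coalitions = {S. S \<noteq> {} \<and> S \<subset> UNIV}"

definition labels :: "('n::finite \<Rightarrow> nat) \<Rightarrow> ('n \<times> nat) set" where
  "labels K = (SIGMA i:UNIV. {1..K i})"

definition multisample :: "'a measure \<Rightarrow> ('n::finite \<Rightarrow> nat) \<Rightarrow> ('n \<times> nat \<Rightarrow> 'a) measure" where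
  "multisample M K = PiM (labels K) (\<lambda>_. M)"

text \<open>Meaningful only if every \<open>K i\<close> is positive, since the maximum of an empty set is unspecified.\<close>

definition scenario_core ::
  "('n::finite set \<Rightarrow> 'a \<Rightarrow> real) \<Rightarrow> real \<Rightarrow> ('n \<Rightarrow> nat) \<Rightarrow> ('n \<times> nat \<Rightarrow> 'a) \<Rightarrow> (real ^ 'n) set" where
  "scenario_core u uN K \<xi> =
     {x. (\<Sum>i\<in>UNIV. x $ i) = uN \<and>
         (\<forall>S\<in>coalitions. (\<Sum>i\<in>S. x $ i) \<ge> (MAX i\<in>S. MAX k\<in>{1..K i}. u S (\<xi> (i, k))))}"

text \<open>The feasible set when only the samples with labels in \<open>J\<close> are used.\<close>

definition reduced_core ::
  "('n::finite set \<Rightarrow> 'a \<Rightarrow> real) \<Rightarrow> real \<Rightarrow> ('n \<times> nat) set \<Rightarrow> ('n \<times> nat \<Rightarrow> 'a) \<Rightarrow> (real ^ 'n) set" where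
  "reduced_core u uN J \<xi> =
     {x. (\<Sum>j\<in>UNIV. x $ j) = uN \<and>
         (\<forall>(i, k)\<in>J. \<forall>S\<in>coalitions. i \<in> S \<longrightarrow> (\<Sum>j\<in>S. x $ j) \<ge> u S (\<xi> (i, k)))}"

text \<open>
  Minimisation with tie-breaking: minimise the first function over \<open>A\<close>, then the second one over
  the set of minimisers so obtained, and so on.  In \<open>minimisers (f # ts) A\<close> the objective is \<open>f\<close>
  and \<open>ts\<close> is the tie-break rule; \<open>ts = []\<close> means that no tie-break is applied.
\<close>

primrec minimisers :: "('b \<Rightarrow> real) list \<Rightarrow> 'b set \<Rightarrow> 'b set" where
  "minimisers [] A = A"
| "minimisers (g # gs) A = minimisers gs {x. is_arg_min g (\<lambda>y. y \<in> A) x}"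

text \<open>
  A compression set is determined from the observed multi-sample, hence it is a function \<open>I\<close> of
  \<open>\<xi>\<close> returning a set of labels.  The solution of the reduced problem must exist, be unique (after
  tie-breaking) and equal \<open>xstar \<xi>\<close>.
\<close>

definition compression_set ::
  "'a measure \<Rightarrow> ('n::finite set \<Rightarrow> 'a \<Rightarrow> real) \<Rightarrow> real \<Rightarrow> ('n \<Rightarrow> nat) \<Rightarrow> (real ^ 'n \<Rightarrow> real) list \<Rightarrow>
   (('n \<times> nat \<Rightarrow> 'a) \<Rightarrow> real ^ 'n) \<Rightarrow> (('n \<times> nat \<Rightarrow> 'a) \<Rightarrow> ('n \<times> nat) set) \<Rightarrow> bool" where
  "compression_set M u uN K gs xstar I \<longleftrightarrow>
     (\<forall>\<xi>\<in>space (multisample M K). I \<xi> \<subseteq> labels K) \<and>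
     (AE \<xi> in multisample M K. minimisers gs (reduced_core u uN (I \<xi>) \<xi>) = {xstar \<xi>})"

definition agent_card ::
  "(('n \<times> nat \<Rightarrow> 'a) \<Rightarrow> ('n \<times> nat) set) \<Rightarrow> 'n \<Rightarrow> ('n \<times> nat \<Rightarrow> 'a) \<Rightarrow> nat" where
  "agent_card I i \<xi> = card {k. (i, k) \<in> I \<xi>}"

definition eps :: "nat \<Rightarrow> real \<Rightarrow> nat \<Rightarrow> nat \<Rightarrow> real" where
  "eps N b K s =
     (if s < K then 1 - (b / ((real N + 1) * real (K choose s))) powr (1 / real (K - s)) else 1)"

end

theory Submission
  imports Defs
begin

text \<open>
  A violated coalition contains some agent \<open>i\<close>, so it suffices to show, for each \<open>i\<close>, that the
  probability of violating a constraint with \<open>i \<in> S\<close> exceeds \<open>\<epsilon>\<^sub>i(s\<^sub>i)\<close> with probability at most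
  \<open>\<beta>\<^sub>i\<close>. Fix the samples of the other agents. Points that are lexicographically better than the
  optimum form a convex set, so by Helly's theorem in \<open>\<real>\<^sup>N\<close> at most \<open>N\<close> of the samples of agent \<open>i\<close> in
  the given compression set already determine the optimum; as \<open>\<epsilon>\<^sub>i\<close> is increasing, we may replace
  the compression set by such a subset \<open>J\<close>. Given the samples in \<open>J\<close>, the other \<open>K\<^sub>i - |J|\<close> samples all
  avoid a violation set of probability more than \<open>\<epsilon>\<^sub>i(|J|)\<close>. The union bound over \<open>J\<close> gives
  \<open>\<beta>\<^sub>i / (N + 1)\<close> for each of the at most \<open>N + 1\<close> sizes. Measurability of the optimum comes from a
  stagewise analysis of the compact-valued argmin maps.
\<close>

subsection \<open>Lexicographic minimisation and Helly\<close>

text \<open>Every subfamily with empty intersection must contain \<open>A\<close>, because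
  \<open>p\<close> lies in all the sets \<open>H k\<close>. Thus \<open>A\<close> takes one of the
  \<open>DIM('a) + 1\<close> places in Helly's theorem and at most \<open>DIM('a)\<close> of the
  \<open>H k\<close> remain.\<close>

lemma Helly_common_point:
  fixes A :: "'a::euclidean_space set" and H :: "'k \<Rightarrow> 'a set"
  assumes "finite Q" "convex A" "\<And>k. k \<in> Q \<Longrightarrow> convex (H k)" "\<And>k. k \<in> Q \<Longrightarrow> p \<in> H k"
    and empty: "A \<inter> (\<Inter>k\<in>Q. H k) = {}"
  obtains J where "J \<subseteq> Q" "card J \<le> DIM('a)" "A \<inter> (\<Inter>k\<in>J. H k) = {}"
proof -
  let ?F = "insert A (H ` Q)"
  have fin: "finite ?F" using assms by simp
  have F0: "\<Inter>?F = {}" using empty by simp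
  obtain t where t: "t \<subseteq> ?F" "card t \<le> DIM('a) + 1" "\<Inter>t = {}"
  \<comment> \<open>Helly's theorem asks for at least \<open>DIM('a) + 1\<close> sets; a smaller
    family is taken whole.\<close>
  proof (cases "card ?F \<ge> DIM('a) + 1")
    case True
    have "\<exists>t. t \<subseteq> ?F \<and> card t = DIM('a) + 1 \<and> \<Inter>t = {}"
      using Helly[OF True] F0 assms by blast
    then show ?thesis using that by auto
  next
    case False
    then show ?thesis using that[of ?F] F0 by simp
  qed
  have "A \<in> t"
  proof (rule ccontr)
    assume "A \<notin> t"
    then have "p \<in> \<Inter>t" using t(1) assms(4) by auto
    then show False using t by simp
  qed
  have "t - {A} \<subseteq> H ` Q" using t(1) by auto
  \<comment> \<open>One index is kept per set, so indices with equal \<open>H k\<close> do not raise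
    the cardinality of \<open>J\<close>.\<close>
  then obtain J where J: "J \<subseteq> Q" "inj_on H J" "t - {A} = H ` J"
    unfolding subset_image_inj by auto
  have "card J = card (t - {A})" using J card_image by metis
  also have "\<dots> \<le> DIM('a)"
    using t(2) \<open>A \<in> t\<close> fin finite_subset[OF t(1)] by simp
  finally have "card J \<le> DIM('a)" .
  moreover have "A \<inter> (\<Inter>k\<in>J. H k) = \<Inter>t"
    using J(3) \<open>A \<in> t\<close> by (metis Inter_insert insert_Diff)
  ultimately show ?thesis using that J t by auto
qed

text \<open>The strict lexicographic order of the successive objectives. It turns stagewise
  minimisation into the absence of a better point, the form in which Helly's theorem
  applies.\<close>

primrec lexless :: "('b \<Rightarrow> real) list \<Rightarrow> 'b \<Rightarrow> 'b \<Rightarrow> bool" where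
  "lexless [] x y \<longleftrightarrow> False"
| "lexless (g # gs) x y \<longleftrightarrow> g x < g y \<or> g x = g y \<and> lexless gs x y"

text \<open>All points that survive the first stage share one value of \<open>g\<close>, so among
  them the later objectives decide just as in the lexicographic order.\<close>

lemma minimisers_lexless: "minimisers gs A = {x \<in> A. \<forall>y\<in>A. \<not> lexless gs y x}"
proof (induction gs arbitrary: A)
  case (Cons g gs)
  let ?m = "{x. is_arg_min g (\<lambda>y. y \<in> A) x}"
  have "x \<in> ?m \<and> (\<forall>y\<in>?m. \<not> lexless gs y x) \<longleftrightarrow> x \<in> A \<and> (\<forall>y\<in>A. \<not> lexless (g # gs) y x)" for x
  proof
    assume x: "x \<in> ?m \<and> (\<forall>y\<in>?m. \<not> lexless gs y x)"
    then have "y \<in> ?m" if "y \<in> A" "g y = g x" for y using that by (auto simp: is_arg_min_def)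
    then show "x \<in> A \<and> (\<forall>y\<in>A. \<not> lexless (g # gs) y x)" using x by (auto simp: is_arg_min_def)
  next
    assume x: "x \<in> A \<and> (\<forall>y\<in>A. \<not> lexless (g # gs) y x)"
    have "g y = g x \<and> y \<in> A" if "y \<in> ?m" for y
    proof -
      have "y \<in> A" "\<not> g x < g y" using that x by (auto simp: is_arg_min_def)
      moreover have "\<not> g y < g x" using x \<open>y \<in> A\<close> by auto
      ultimately show ?thesis by simp
    qed
    then show "x \<in> ?m \<and> (\<forall>y\<in>?m. \<not> lexless gs y x)" using x by (auto simp: is_arg_min_def)
  qed
  then show ?case by (auto simp only: minimisers.simps Cons)
qed simp

lemma minimisers_subset: "minimisers gs A \<subseteq> A"
  unfolding minimisers_lexless by blast

text \<open>As soon as one final minimiser over \<open>B\<close> lies in \<open>A\<close>, the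
  optimal value of each stage is the same for both sets, and each argmin set over \<open>A\<close>
  is the trace of the one over \<open>B\<close>.\<close>

lemma minimisers_mono:
  assumes "A \<subseteq> B" "minimisers gs B \<inter> A \<noteq> {}"
  shows "minimisers gs A = minimisers gs B \<inter> A"
  using assms
proof (induction gs arbitrary: A B)
  case (Cons g gs)
  let ?m = "\<lambda>A. {x. is_arg_min g (\<lambda>y. y \<in> A) x}"
  obtain z where "z \<in> ?m B" "z \<in> A"
    using Cons.prems minimisers_subset[of gs "?m B"] by auto
  then have z: "z \<in> A" "z \<in> B" "\<And>y. y \<in> B \<Longrightarrow> g z \<le> g y" by (auto simp: is_arg_min_def not_less)
  have eq: "?m A = ?m B \<inter> A"
  proof (intro equalityI subsetI)
    fix x assume "x \<in> ?m A"
    then have x: "x \<in> A" "g x \<le> g z" using z(1) by (auto simp: is_arg_min_def not_less)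
    have "g x \<le> g y" if "y \<in> B" for y using x(2) z(3)[OF that] by simp
    then show "x \<in> ?m B \<inter> A" using x(1) Cons.prems(1) by (auto simp: is_arg_min_def not_less)
  next
    fix x assume "x \<in> ?m B \<inter> A"
    then show "x \<in> ?m A" using Cons.prems(1) by (auto simp: is_arg_min_def)
  qed
  have "minimisers gs (?m B) \<inter> ?m A \<noteq> {}"
    using Cons.prems eq minimisers_subset[of gs "?m B"] by auto
  then have "minimisers gs (?m A) = minimisers gs (?m B) \<inter> ?m A"
    using eq by (intro Cons.IH) auto
  then show ?case using eq minimisers_subset[of gs "?m B"] by auto
qed auto

text \<open>If both endpoints tie with \<open>x\<close> in \<open>g\<close>, convexity keeps
  \<open>g\<close> at or below \<open>g x\<close> and the later objectives settle a tie. If one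
  endpoint is strictly better in \<open>g\<close>, so is every point with two positive
  weights.\<close>

lemma convex_lexless:
  fixes x :: "'b::real_vector"
  assumes "\<And>g. g \<in> set gs \<Longrightarrow> convex_on UNIV g"
  shows "convex {y. lexless gs y x}"
  using assms
proof (induction gs)
  case (Cons g gs)
  have C: "convex {y. lexless gs y x}" by (rule Cons.IH) (use Cons.prems in auto)
  have g: "convex_on UNIV g" using Cons.prems by auto
  show ?case
  proof (rule convexI, simp only: mem_Collect_eq)
    fix y z and a b :: real
    assume y: "lexless (g # gs) y x" and z: "lexless (g # gs) z x" and ab: "0 \<le> a" "0 \<le> b" "a + b = 1"
    have le: "g y \<le> g x" "g z \<le> g x" using y z by auto
    have conv: "g (a *\<^sub>R y + b *\<^sub>R z) \<le> a * g y + b * g z"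
      using g ab by (simp add: convex_on_def)
    show "lexless (g # gs) (a *\<^sub>R y + b *\<^sub>R z) x"
    proof (cases "a = 0 \<or> b = 0")
      case True
      then show ?thesis using y z ab by auto
    next
      case False
      then have pos: "a > 0" "b > 0" using ab by auto
      show ?thesis
      proof (cases "g y = g x \<and> g z = g x")
        case True
        then have "lexless gs y x" "lexless gs z x" using y z by auto
        then have "lexless gs (a *\<^sub>R y + b *\<^sub>R z) x"
          using convexD[OF C, of y z a b] ab by auto
        moreover have "g (a *\<^sub>R y + b *\<^sub>R z) \<le> g x"
          using conv True ab by (metis distrib_right mult_1)
        ultimately show ?thesis by auto
      next
        case False
        have "a * (g x - g y) + b * (g x - g z) > 0"
        proof (cases "g y < g x")
          case True
          then show ?thesis using pos le by (intro add_pos_nonneg mult_pos_pos mult_nonneg_nonneg) auto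
        next
          case F: False
          then have "g z < g x" using False le by auto
          then show ?thesis using pos le by (intro add_nonneg_pos mult_pos_pos mult_nonneg_nonneg) auto
        qed
        then have "a * g y + b * g z < (a + b) * g x" by (simp add: algebra_simps)
        then have "a * g y + b * g z < g x" using ab by simp
        then show ?thesis using conv by simp
      qed
    qed
  qed
qed simp

subsection \<open>The bound function and product measures\<close>

lemma eps_le_1: "0 < b \<Longrightarrow> eps N b K s \<le> 1"
  by (simp add: eps_def)

text \<open>With \<open>q\<close>, \<open>c\<close>, \<open>d\<close>, \<open>n\<close> as below,
  taking logarithms reduces the claim to \<open>(q * c) ^ n \<le> (q * d) ^ Suc n\<close>. As
  \<open>q \<ge> 1\<close>, it is enough that \<open>c ^ n \<le> d ^ Suc n\<close>, which follows
  from the ratio of consecutive binomial coefficients.\<close>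

lemma eps_le_Suc:
  assumes b: "0 < b" "b \<le> real N + 1" and s: "s < K"
  shows "eps N b K s \<le> eps N b K (Suc s)"
proof (cases "Suc s = K")
  case True
  then show ?thesis by (simp add: eps_def)
next
  case False
  define n where "n = K - Suc s"
  have n: "n \<ge> 1" "K - s = Suc n" "Suc s < K" "K = s + Suc n" using False s by (auto simp: n_def)
  define q where "q = (real N + 1) / b"
  have q: "q \<ge> 1" using b by (simp add: q_def)
  define c d where "c = real (K choose s)" and "d = real (K choose Suc s)"
  have pos: "c \<ge> 1" "d \<ge> 1" "c > 0" "d > 0"
    using s by (auto simp: c_def d_def Suc_leI)
  have "real (Suc s) * d = real (K - s) * c"
    unfolding c_def d_def by (metis binomial_absorption binomial_absorb_comp of_nat_mult)
  then have d: "d = c * (real (Suc n) / real (Suc s))" using n by (simp add: field_simps)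
  \<comment> \<open>The lower bound \<open>(K / m) ^ m\<close> for \<open>K choose m\<close> is used
    at \<open>m = Suc n\<close>, the complement of \<open>s\<close> in \<open>K\<close>.\<close>
  have "(real (Suc s) / real (Suc n)) ^ Suc n \<le> (real K / real (Suc n)) ^ Suc n"
    using n by (intro power_mono divide_right_mono) auto
  also have "\<dots> \<le> real (K choose Suc n)"
    using n by (intro binomial_ge_n_over_k_pow_k) auto
  also have "K choose Suc n = K choose s"
    using n binomial_symmetric[of s K] by simp
  finally have 1: "(real (Suc s) / real (Suc n)) ^ Suc n \<le> c" by (simp add: c_def)
  have "(q * c) ^ n \<le> q ^ Suc n * c ^ n"
    using q pos by (simp add: power_mult_distrib)
  also have "c ^ n \<le> d ^ Suc n"
  proof -
    have "d ^ Suc n * (real (Suc s) / real (Suc n)) ^ Suc n = c ^ Suc n"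
      unfolding d power_mult_distrib[symmetric] by simp
    then have "c ^ Suc n \<le> d ^ Suc n * c"
      using 1 pos by (metis mult_left_mono zero_le_power less_imp_le)
    then show ?thesis using pos by simp
  qed
  finally have 2: "(q * c) ^ n \<le> (q * d) ^ Suc n"
    using q by (simp add: power_mult_distrib mult_left_mono)
  have qc: "q * c > 0" "q * d > 0" using q pos by auto
  have "real n * ln (q * c) \<le> real (Suc n) * ln (q * d)"
    using 2 qc ln_le_cancel_iff[of "(q*c)^n" "(q*d)^Suc n"] ln_realpow[of "q*c" n] ln_realpow[of "q*d" "Suc n"]
    by (metis zero_less_power)
  then have "ln (q * c) / real (Suc n) \<le> ln (q * d) / real n"
    using n by (simp add: field_simps)
  then have "- (ln (q * d) / real n) \<le> - (ln (q * c) / real (Suc n))" by simp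
  moreover have "b / ((real N + 1) * c) = inverse (q * c)" "b / ((real N + 1) * d) = inverse (q * d)"
    using b by (auto simp: q_def field_simps)
  moreover have "eps N b K s = 1 - inverse (q * c) powr (1 / real (Suc n))"
    unfolding eps_def c_def[symmetric] calculation(2) using n(2) s by simp
  moreover have "eps N b K (Suc s) = 1 - inverse (q * d) powr (1 / real n)"
    unfolding eps_def d_def[symmetric] calculation(3) n_def[symmetric] using n(3) by simp
  ultimately show ?thesis
    using qc q pos by (simp only: powr_def ln_inverse) auto
qed

text \<open>This permits shrinking a compression set: the smaller set only lowers the threshold that
  the violation probability exceeds.\<close>

lemma eps_mono:
  assumes "0 < b" "b \<le> real N + 1" "s \<le> t" "t \<le> K"
  shows "eps N b K s \<le> eps N b K t"
  using assms(3,4)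
proof (induction t rule: dec_induct)
  case (step t)
  then show ?case using eps_le_Suc[of b N t K] assms by simp
qed simp

text \<open>The calibration behind \<open>eps\<close>: a union bound over all index sets of size
  \<open>s\<close> costs exactly \<open>b / (N + 1)\<close>.\<close>

lemma eps_power:
  assumes "0 < b" "s < K"
  shows "real (K choose s) * (1 - eps N b K s) ^ (K - s) = b / (real N + 1)"
proof -
  have c: "real (K choose s) > 0" using assms by simp
  define y where "y = b / ((real N + 1) * real (K choose s))"
  have y: "y > 0" using assms c by (simp add: y_def)
  have "(1 - eps N b K s) ^ (K - s) = (y powr (1 / real (K - s))) ^ (K - s)"
    using assms by (simp add: eps_def y_def)
  also have "\<dots> = y" using y assms by (simp add: powr_power)
  finally show ?thesis using c by (simp add: y_def)
qed

text \<open>By Fubini the coordinates in \<open>B\<close> are integrated first. For fixed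
  \<open>\<eta>\<close> they are independent and must all avoid a set of probability at least
  \<open>e\<close>. The set may vary with \<open>\<eta>\<close> in any way, since only the value of
  the inner integral is estimated.\<close>

lemma (in prob_space) PiM_split_bound:
  fixes A B :: "'i set"
  assumes fin: "finite A" "finite B" "A \<inter> B = {}"
    and E: "E \<in> sets (PiM (A \<union> B) (\<lambda>_. M))"
    and AE: "AE \<eta> in PiM A (\<lambda>_. M). \<exists>V\<in>sets M. e \<le> prob V \<and>
      (AE \<zeta> in PiM B (\<lambda>_. M). merge A B (\<eta>, \<zeta>) \<in> E \<longrightarrow> (\<forall>l\<in>B. \<zeta> l \<notin> V))"
  shows "measure (PiM (A \<union> B) (\<lambda>_. M)) E \<le> (1 - e) ^ card B"
proof -
  interpret P: product_sigma_finite "\<lambda>_::'i. M" by standard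
  interpret PA: prob_space "PiM A (\<lambda>_. M)" by (intro prob_space_PiM) (rule prob_space_axioms)
  interpret PAB: prob_space "PiM (A \<union> B) (\<lambda>_. M)" by (intro prob_space_PiM) (rule prob_space_axioms)
  note [measurable] = E
  have bound: "(\<integral>\<^sup>+ \<zeta>. indicator E (merge A B (\<eta>, \<zeta>)) \<partial>PiM B (\<lambda>_. M)) \<le> ennreal ((1 - e) ^ card B)"
    if eta: "\<eta> \<in> space (PiM A (\<lambda>_. M))" and V: "V \<in> sets M" "e \<le> prob V"
      and ae: "AE \<zeta> in PiM B (\<lambda>_. M). merge A B (\<eta>, \<zeta>) \<in> E \<longrightarrow> (\<forall>l\<in>B. \<zeta> l \<notin> V)" for \<eta> V
  proof -
    let ?W = "PiE B (\<lambda>_. space M - V)"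
    have W: "?W \<in> sets (PiM B (\<lambda>_. M))" using V fin by (intro sets_PiM_I_finite) auto
    have "(\<integral>\<^sup>+ \<zeta>. indicator E (merge A B (\<eta>, \<zeta>)) \<partial>PiM B (\<lambda>_. M))
        \<le> (\<integral>\<^sup>+ \<zeta>. indicator ?W \<zeta> \<partial>PiM B (\<lambda>_. M))"
    proof (rule nn_integral_mono_AE)
      show "AE \<zeta> in PiM B (\<lambda>_. M). indicator E (merge A B (\<eta>, \<zeta>)) \<le> (indicator ?W \<zeta> :: ennreal)"
        using ae AE_space
      proof eventually_elim
        case (elim \<zeta>)
        then show ?case by (auto simp: space_PiM indicator_def PiE_iff)
      qed
    qed
    also have "\<dots> = emeasure (PiM B (\<lambda>_. M)) ?W" using W by simp
    also have "\<dots> = (\<Prod>l\<in>B. emeasure M (space M - V))"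
      using fin V by (intro P.emeasure_PiM) auto
    also have "\<dots> = ennreal ((1 - prob V) ^ card B)"
      using V by (simp add: emeasure_eq_measure prob_compl ennreal_power)
    also have "\<dots> \<le> ennreal ((1 - e) ^ card B)"
      using V by (intro ennreal_leI power_mono) auto
    finally show ?thesis .
  qed
  have "emeasure (PiM (A \<union> B) (\<lambda>_. M)) E = (\<integral>\<^sup>+ \<xi>. indicator E \<xi> \<partial>PiM (A \<union> B) (\<lambda>_. M))" by simp
  also have "\<dots> = (\<integral>\<^sup>+ \<eta>. (\<integral>\<^sup>+ \<zeta>. indicator E (merge A B (\<eta>, \<zeta>)) \<partial>PiM B (\<lambda>_. M)) \<partial>PiM A (\<lambda>_. M))"
    using fin by (intro P.product_nn_integral_fold) auto
  also have "\<dots> \<le> (\<integral>\<^sup>+ \<eta>. ennreal ((1 - e) ^ card B) \<partial>PiM A (\<lambda>_. M))"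
    using AE AE_space by (intro nn_integral_mono_AE, eventually_elim) (use bound in blast)
  also have "\<dots> = ennreal ((1 - e) ^ card B)" by (simp add: PA.emeasure_space_1)
  finally have le: "ennreal (PAB.prob E) \<le> ennreal ((1 - e) ^ card B)"
    by (simp add: PAB.emeasure_eq_measure)
  \<comment> \<open>This makes the right-hand side nonnegative, so that the inequality in
    \<open>ennreal\<close> yields one between reals.\<close>
  have "e \<le> 1"
  proof -
    have "AE \<eta> in PiM A (\<lambda>_. M). e \<le> 1"
      using AE by eventually_elim (meson order.trans prob_le_1)
    then show ?thesis by simp
  qed
  then show ?thesis using le by (simp add: ennreal_le_iff)
qed

text \<open>The product over \<open>A \<union> B\<close> is the image of the pair measure under
  \<open>merge\<close>, so a null set has null sections for almost every
  \<open>\<eta>\<close>.\<close>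

lemma (in prob_space) AE_PiM_merge:
  fixes A B :: "'i set"
  assumes fin: "finite A" "finite B" "A \<inter> B = {}"
    and AE: "AE \<xi> in PiM (A \<union> B) (\<lambda>_. M). P \<xi>"
  shows "AE \<eta> in PiM A (\<lambda>_. M). AE \<zeta> in PiM B (\<lambda>_. M). P (merge A B (\<eta>, \<zeta>))"
proof -
  interpret P: product_sigma_finite "\<lambda>_::'i. M" by standard
  interpret PA: prob_space "PiM A (\<lambda>_. M)" by (intro prob_space_PiM) (rule prob_space_axioms)
  interpret PB: prob_space "PiM B (\<lambda>_. M)" by (intro prob_space_PiM) (rule prob_space_axioms)
  interpret PP: pair_sigma_finite "PiM A (\<lambda>_. M)" "PiM B (\<lambda>_. M)" ..
  have "AE \<xi> in distr (PiM A (\<lambda>_. M) \<Otimes>\<^sub>M PiM B (\<lambda>_. M)) (PiM (A \<union> B) (\<lambda>_. M)) (merge A B). P \<xi>"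
    by (subst P.distr_merge[OF fin(3,1,2)]) (rule AE)
  then have "AE x in PiM A (\<lambda>_. M) \<Otimes>\<^sub>M PiM B (\<lambda>_. M). P (merge A B x)"
    by (rule AE_distrD[rotated]) simp
  then show ?thesis by (rule PP.AE_pair)
qed

subsection \<open>Measurability of minimisers\<close>

text \<open>The uncountable choice of \<open>x\<close> is replaced by a choice from a countable
  dense subset with slack \<open>1 / (n + 1)\<close>. Strict inequalities are open conditions, which
  gives one direction; a convergent subsequence of slack solutions in \<open>C\<close> gives the
  other.\<close>

lemma sets_Collect_compact_feasible:
  fixes a :: "'t \<Rightarrow> 'b::euclidean_space \<Rightarrow> real"
  assumes C: "compact C" and T: "finite T"
    and a: "\<And>t. t \<in> T \<Longrightarrow> continuous_on UNIV (a t)"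
    and h: "\<And>t. t \<in> T \<Longrightarrow> h t \<in> borel_measurable \<Omega>"
  shows "{\<omega> \<in> space \<Omega>. \<exists>x\<in>C. \<forall>t\<in>T. h t \<omega> \<le> a t x} \<in> sets \<Omega>"
proof -
  obtain D where D: "countable D" "D \<subseteq> C" "C \<subseteq> closure D"
    using separable[of C] by blast
  have "(\<exists>x\<in>C. \<forall>t\<in>T. h t \<omega> \<le> a t x) \<longleftrightarrow> (\<forall>n::nat. \<exists>x\<in>D. \<forall>t\<in>T. h t \<omega> - 1 / real (Suc n) < a t x)"
    (is "?L \<longleftrightarrow> ?R") for \<omega>
  proof
    assume ?L
    then obtain x where x: "x \<in> C" "\<And>t. t \<in> T \<Longrightarrow> h t \<omega> \<le> a t x" by blast
    show ?R
    proof
      fix n :: nat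
      let ?U = "\<Inter>t\<in>T. {y. h t \<omega> - 1 / real (Suc n) < a t y}"
      have "open ?U" using T a by (intro open_INT ballI open_Collect_less) auto
      moreover have "h t \<omega> - 1 / real (Suc n) < a t x" if "t \<in> T" for t
        using x(2)[OF that] by (smt (verit) of_nat_0_less_iff zero_less_Suc zero_less_divide_1_iff)
      then have "x \<in> ?U" by auto
      moreover have "x \<in> closure D" using x D by auto
      ultimately have "D \<inter> ?U \<noteq> {}"
        using open_Int_closure_eq_empty[of ?U D] by auto
      then show "\<exists>x\<in>D. \<forall>t\<in>T. h t \<omega> - 1 / real (Suc n) < a t x" by auto
    qed
  next
    assume ?R
    then obtain d where d: "\<And>n. d n \<in> D" "\<And>n t. t \<in> T \<Longrightarrow> h t \<omega> - 1 / real (Suc n) < a t (d n)"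
      by metis
    have "\<forall>n. d n \<in> C" using d D by auto
    then obtain x r where x: "x \<in> C" "strict_mono (r :: nat \<Rightarrow> nat)" "(d \<circ> r) \<longlonglongrightarrow> x"
      using C unfolding compact_def by meson
    have "h t \<omega> \<le> a t x" if t: "t \<in> T" for t
    proof (rule LIMSEQ_le)
      have "(\<lambda>n. 1 / real (Suc (r n))) \<longlonglongrightarrow> 0"
        using LIMSEQ_subseq_LIMSEQ[OF LIMSEQ_inverse_real_of_nat x(2)] by (simp add: o_def inverse_eq_divide)
      then show "(\<lambda>n. h t \<omega> - 1 / real (Suc (r n))) \<longlonglongrightarrow> h t \<omega>"
        using tendsto_diff[of "\<lambda>_. h t \<omega>" "h t \<omega>" sequentially] by fastforce
      show "(\<lambda>n. a t (d (r n))) \<longlonglongrightarrow> a t x"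
        using continuous_on_tendsto_compose[OF a[OF t] x(3)] by (simp add: o_def)
      show "\<exists>N. \<forall>n\<ge>N. h t \<omega> - 1 / real (Suc (r n)) \<le> a t (d (r n))"
        using d(2)[OF t] less_imp_le by blast
    qed
    then show ?L using x by auto
  qed
  then have "{\<omega> \<in> space \<Omega>. \<exists>x\<in>C. \<forall>t\<in>T. h t \<omega> \<le> a t x} =
      {\<omega> \<in> space \<Omega>. \<forall>n::nat. \<exists>x\<in>D. \<forall>t\<in>T. h t \<omega> - 1 / real (Suc n) < a t x}" by simp
  also have "\<dots> \<in> sets \<Omega>"
  proof (intro sets.sets_Collect_countable_All sets.sets_Collect_countable_Ex' D(1))
    fix n :: nat and x
    have "Measurable.pred \<Omega> (\<lambda>\<omega>. h t \<omega> - 1 / real (Suc n) < a t x)" if "t \<in> T" for t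
      using h[OF that] by measurable
    then show "{\<omega> \<in> space \<Omega>. \<forall>t\<in>T. h t \<omega> - 1 / real (Suc n) < a t x} \<in> sets \<Omega>"
      using T by (cases "T = {}") (auto simp: pred_def intro!: sets.sets_Collect_finite_All')
  qed
  finally show ?thesis .
qed

lemma compact_argmin:
  fixes A :: "'b::euclidean_space set" and g :: "'b \<Rightarrow> real"
  assumes A: "compact A" "A \<noteq> {}" and g: "continuous_on UNIV g"
  shows "compact {x. is_arg_min g (\<lambda>y. y \<in> A) x}" "{x. is_arg_min g (\<lambda>y. y \<in> A) x} \<noteq> {}"
proof -
  have gA: "continuous_on A g" using g continuous_on_subset by blast
  obtain z where z: "z \<in> A" "\<And>y. y \<in> A \<Longrightarrow> g z \<le> g y"
    using continuous_attains_inf[of A g] A gA by blast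
  have "{x. is_arg_min g (\<lambda>y. y \<in> A) x} = A \<inter> {x. g x \<le> g z}"
    using z by (force simp: is_arg_min_def not_less)
  moreover have "closed {x. g x \<le> g z}" by (intro closed_Collect_le g continuous_on_const)
  ultimately show "compact {x. is_arg_min g (\<lambda>y. y \<in> A) x}"
    using A by (simp add: compact_Int_closed)
  show "{x. is_arg_min g (\<lambda>y. y \<in> A) x} \<noteq> {}"
    using z by (force simp: is_arg_min_def not_less)
qed

text \<open>The argmin set meets \<open>C\<close> iff the minimum over \<open>A\<close> is attained
  in \<open>C\<close>. Testing sublevel sets at rational heights expresses this by countably many
  statements that \<open>A\<close> meets a closed set, so measurability can pass through one stage
  of minimisation.\<close>

lemma argmin_hits_closed_iff:
  fixes A :: "'b::euclidean_space set" and g :: "'b \<Rightarrow> real"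
  assumes A: "compact A" "A \<noteq> {}" and g: "continuous_on UNIV g" and C: "closed C"
  shows "{x. is_arg_min g (\<lambda>y. y \<in> A) x} \<inter> C \<noteq> {} \<longleftrightarrow>
    (\<forall>q\<in>\<rat>. A \<inter> {x. g x \<le> q} \<noteq> {} \<longrightarrow> A \<inter> (C \<inter> {x. g x \<le> q}) \<noteq> {})" (is "?L \<longleftrightarrow> ?R")
proof
  assume ?L
  then obtain x where x: "is_arg_min g (\<lambda>y. y \<in> A) x" "x \<in> C" by auto
  then have le: "g x \<le> q" if "y \<in> A" "g y \<le> q" for y q
    using that by (auto simp: is_arg_min_def not_less intro: order.trans)
  then show ?R using x by (auto simp: is_arg_min_def)
next
  assume R: ?R
  \<comment> \<open>A rational above some value of \<open>g\<close> on \<open>A\<close> shows that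
    \<open>A \<inter> C\<close> is nonempty, so \<open>g\<close> has a minimum on it.\<close>
  obtain y where "y \<in> A" using A by auto
  moreover obtain q where "q \<in> \<rat>" "g y < q" using Rats_dense_in_real[of "g y" "g y + 1"] by auto
  ultimately have "A \<inter> C \<noteq> {}" using R by fastforce
  moreover have "compact (A \<inter> C)" using A C by (intro compact_Int_closed)
  ultimately obtain x where x: "x \<in> A \<inter> C" "\<And>y. y \<in> A \<inter> C \<Longrightarrow> g x \<le> g y"
    using continuous_attains_inf[of "A \<inter> C" g] g continuous_on_subset by blast
  have "g x \<le> g y" if y: "y \<in> A" for y
  proof (rule ccontr)
    assume "\<not> g x \<le> g y"
    then obtain q where q: "q \<in> \<rat>" "g y < q" "q < g x" using Rats_dense_in_real by (meson not_le)
    then have "A \<inter> (C \<inter> {x. g x \<le> q}) \<noteq> {}" using R y by fastforce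
    then show False using x q by force
  qed
  then show ?L using x by (auto simp: is_arg_min_def not_less)
qed

text \<open>The induction carries a set-valued map with nonempty compact values whose hitting events
  for closed sets are measurable; its argmin map inherits all three properties.\<close>

lemma sets_Collect_minimisers_hit:
  fixes \<Phi> :: "'w \<Rightarrow> 'b::euclidean_space set"
  assumes "\<And>\<omega>. \<omega> \<in> space \<Omega> \<Longrightarrow> compact (\<Phi> \<omega>)" "\<And>\<omega>. \<omega> \<in> space \<Omega> \<Longrightarrow> \<Phi> \<omega> \<noteq> {}"
    and "\<And>C. closed C \<Longrightarrow> {\<omega> \<in> space \<Omega>. \<Phi> \<omega> \<inter> C \<noteq> {}} \<in> sets \<Omega>"
    and "\<And>g. g \<in> set gs \<Longrightarrow> continuous_on UNIV g" and "closed C"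
  shows "{\<omega> \<in> space \<Omega>. minimisers gs (\<Phi> \<omega>) \<inter> C \<noteq> {}} \<in> sets \<Omega>"
  using assms
proof (induction gs arbitrary: \<Phi> C)
  case (Cons g gs)
  let ?\<Psi> = "\<lambda>\<omega>. {x. is_arg_min g (\<lambda>y. y \<in> \<Phi> \<omega>) x}"
  have g: "continuous_on UNIV g" using Cons.prems by auto
  have le: "closed {x. g x \<le> q}" for q by (intro closed_Collect_le g continuous_on_const)
  have "{\<omega> \<in> space \<Omega>. minimisers gs (?\<Psi> \<omega>) \<inter> C \<noteq> {}} \<in> sets \<Omega>"
  proof (rule Cons.IH)
    fix \<omega> assume w: "\<omega> \<in> space \<Omega>"
    show "compact (?\<Psi> \<omega>)" "?\<Psi> \<omega> \<noteq> {}"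
      by (rule compact_argmin[OF Cons.prems(1)[OF w] Cons.prems(2)[OF w] g])+
  next
    fix C :: "'b set" assume C: "closed C"
    have "{\<omega> \<in> space \<Omega>. ?\<Psi> \<omega> \<inter> C \<noteq> {}} = {\<omega> \<in> space \<Omega>. \<forall>q\<in>\<rat>.
        \<Phi> \<omega> \<inter> {x. g x \<le> q} \<noteq> {} \<longrightarrow> \<Phi> \<omega> \<inter> (C \<inter> {x. g x \<le> q}) \<noteq> {}}"
      using argmin_hits_closed_iff[OF Cons.prems(1,2) g C] by blast
    also have "\<dots> \<in> sets \<Omega>"
      using C le by (intro sets.sets_Collect_countable_All' sets.sets_Collect_imp Cons.prems(3))
        (auto simp: countable_rat intro: closed_Int)
    finally show "{\<omega> \<in> space \<Omega>. ?\<Psi> \<omega> \<inter> C \<noteq> {}} \<in> sets \<Omega>" .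
  qed (use Cons.prems in auto)
  then show ?case by simp
qed simp

section \<open>Reduced cores: convexity, compactness and measurability\<close>

lemma finite_labels: "finite (labels K)"
  by (simp add: labels_def)

lemma scenario_core_eq_reduced_core:
  assumes "\<And>i. K i \<ge> 1"
  shows "scenario_core u uN K \<xi> = reduced_core u uN (labels K) \<xi>"
proof -
  have "(MAX i\<in>S. MAX k\<in>{1..K i}. u S (\<xi> (i, k))) \<le> c \<longleftrightarrow> (\<forall>i\<in>S. \<forall>k\<in>{1..K i}. u S (\<xi> (i, k)) \<le> c)"
    if "S \<in> coalitions" for S c
  proof -
    have "S \<noteq> {}" "\<And>i. {1..K i} \<noteq> {}" using that assms by (auto simp: coalitions_def Suc_le_eq)
    then show ?thesis by (simp add: Max_le_iff)
  qed
  then show ?thesis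
    by (auto simp: scenario_core_def reduced_core_def labels_def) 
qed

lemma reduced_core_antimono: "J \<subseteq> J' \<Longrightarrow> reduced_core u uN J' \<xi> \<subseteq> reduced_core u uN J \<xi>"
  by (force simp: reduced_core_def)

lemma closed_reduced_core: "closed (reduced_core u uN J \<xi>)"
proof -
  have "reduced_core u uN J \<xi> = {x. (\<Sum>j\<in>UNIV. x $ j) = uN} \<inter>
    (\<Inter>p\<in>J. \<Inter>S\<in>{S \<in> coalitions. fst p \<in> S}. {x. u S (\<xi> p) \<le> (\<Sum>j\<in>S. x $ j)})"
    by (force simp: reduced_core_def)
  also have "closed \<dots>"
    by (intro closed_Int closed_INT ballI closed_Collect_eq closed_Collect_le continuous_intros)
  finally show ?thesis .
qed

lemma convex_reduced_core: "convex (reduced_core u uN J \<xi>)"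
proof -
  have "reduced_core u uN J \<xi> = {x. (\<Sum>j\<in>UNIV. x $ j) = uN} \<inter>
    (\<Inter>p\<in>J. \<Inter>S\<in>{S \<in> coalitions. fst p \<in> S}. {x. u S (\<xi> p) \<le> (\<Sum>j\<in>S. x $ j)})"
    by (force simp: reduced_core_def)
  also have "convex \<dots>"
  proof (intro convex_Int convex_INT)
    show "convex {x :: real ^ 'a. (\<Sum>j\<in>UNIV. x $ j) = uN}"
      by (rule convexI) (simp add: sum.distrib sum_distrib_left[symmetric] distrib_right[symmetric])
    show "convex {x :: real ^ 'a. c \<le> (\<Sum>j\<in>S. x $ j)}" for c S
    proof (rule convexI, simp add: sum.distrib sum_distrib_left[symmetric])
      fix x y :: "real ^ 'a" and a b :: real
      assume c: "c \<le> (\<Sum>j\<in>S. x $ j)" "c \<le> (\<Sum>j\<in>S. y $ j)" and ab: "0 \<le> a" "0 \<le> b" "a + b = 1"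
      have "c = a * c + b * c" using ab by (simp flip: distrib_right)
      also have "\<dots> \<le> a * (\<Sum>j\<in>S. x $ j) + b * (\<Sum>j\<in>S. y $ j)"
        using c ab by (intro add_mono mult_left_mono)
      finally show "c \<le> a * (\<Sum>j\<in>S. x $ j) + b * (\<Sum>j\<in>S. y $ j)" .
    qed
  qed
  finally show ?thesis .
qed

text \<open>The singleton coalition of each sampled agent bounds its coordinate from below; the
  fixed total then bounds every coordinate from above.\<close>

lemma compact_reduced_core:
  assumes "\<And>i. \<exists>k. (i, k) \<in> J"
  shows "compact (reduced_core u uN J \<xi>)"
proof -
  obtain k where k: "\<And>i. (i, k i) \<in> J" using assms by metis
  \<comment> \<open>With a single agent, \<open>{i}\<close> is the grand coalition and not in
    \<open>coalitions\<close>; the coordinate then equals \<open>uN\<close>.\<close>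
  define l where "l i = (if {i} \<in> coalitions then u {i} (\<xi> (i, k i)) else uN)" for i
  have low: "l i \<le> x $ i" if x: "x \<in> reduced_core u uN J \<xi>" for x i
  proof (cases "{i} \<in> coalitions")
    case True
    then show ?thesis using x k[of i] by (force simp: reduced_core_def l_def)
  next
    case False
    then have "UNIV = {i}" by (auto simp: coalitions_def)
    then have "(\<Sum>j\<in>UNIV. x $ j) = x $ i" by (metis sum.insert sum.empty finite.emptyI empty_iff add_0_right)
    then show ?thesis using x False by (simp add: reduced_core_def l_def)
  qed
  have up: "x $ i \<le> uN - (\<Sum>j\<in>UNIV - {i}. l j)" if x: "x \<in> reduced_core u uN J \<xi>" for x i
  proof -
    have "uN = x $ i + (\<Sum>j\<in>UNIV - {i}. x $ j)"
      using x by (simp add: reduced_core_def flip: sum.remove)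
    moreover have "(\<Sum>j\<in>UNIV - {i}. l j) \<le> (\<Sum>j\<in>UNIV - {i}. x $ j)" using low[OF x] by (rule sum_mono)
    ultimately show ?thesis by simp
  qed
  have "reduced_core u uN J \<xi> \<subseteq> cbox (\<chi> i. l i) (\<chi> i. uN - (\<Sum>j\<in>UNIV - {i}. l j))"
    using low up by (auto simp: mem_box_cart)
  then have "bounded (reduced_core u uN J \<xi>)" using bounded_cbox bounded_subset by blast
  then show ?thesis using closed_reduced_core by (simp add: compact_eq_bounded_closed)
qed

text \<open>The closed set, cut with the hyperplane of total \<open>uN\<close>, is exhausted by the
  compact pieces \<open>C' n\<close>. On each piece only finitely many inequalities remain,
  continuous in \<open>x\<close> and measurable in the samples.\<close>

lemma sets_Collect_reduced_core_hit:
  fixes u :: "'n::finite set \<Rightarrow> 'a \<Rightarrow> real"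
  assumes u: "\<And>S. S \<in> coalitions \<Longrightarrow> u S \<in> borel_measurable M" and J: "finite J" and C: "closed C"
  shows "{\<xi> \<in> space (PiM J (\<lambda>_. M)). reduced_core u uN J \<xi> \<inter> C \<noteq> {}} \<in> sets (PiM J (\<lambda>_. M))"
proof -
  let ?P = "PiM J (\<lambda>_. M)"
  let ?T = "{(p, S). p \<in> J \<and> S \<in> coalitions \<and> fst p \<in> S}"
  define C' where "C' n = C \<inter> {x :: real ^ 'n. (\<Sum>j\<in>UNIV. x $ j) = uN} \<inter> cball 0 (real n)" for n
  have C': "compact (C' n)" for n
    unfolding C'_def by (intro closed_Int_compact closed_Int C compact_cball closed_Collect_eq continuous_intros)
  have T: "finite ?T" by (rule finite_subset[of _ "J \<times> UNIV"]) (use J in auto)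
  have "(reduced_core u uN J \<xi> \<inter> C \<noteq> {}) \<longleftrightarrow>
    (\<exists>n. \<exists>x\<in>C' n. \<forall>t\<in>?T. u (snd t) (\<xi> (fst t)) \<le> (\<Sum>j\<in>snd t. x $ j))" (is "?L \<longleftrightarrow> ?R") for \<xi>
  proof
    assume ?L
    then obtain x where x: "x \<in> reduced_core u uN J \<xi>" "x \<in> C" by auto
    obtain n where "norm x \<le> real n" using real_arch_simple by blast
    then have "x \<in> C' n" using x by (auto simp: C'_def reduced_core_def)
    moreover have "\<forall>t\<in>?T. u (snd t) (\<xi> (fst t)) \<le> (\<Sum>j\<in>snd t. x $ j)"
      using x by (force simp: reduced_core_def)
    ultimately show ?R by blast
  next
    assume ?R
    then obtain n x where x: "x \<in> C' n" "\<forall>t\<in>?T. u (snd t) (\<xi> (fst t)) \<le> (\<Sum>j\<in>snd t. x $ j)" by blast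
    then have "x \<in> reduced_core u uN J \<xi> \<inter> C" by (force simp: reduced_core_def C'_def)
    then show ?L by blast
  qed
  then have "{\<xi> \<in> space ?P. reduced_core u uN J \<xi> \<inter> C \<noteq> {}} = {\<xi> \<in> space ?P.
    \<exists>n. \<exists>x\<in>C' n. \<forall>t\<in>?T. u (snd t) (\<xi> (fst t)) \<le> (\<Sum>j\<in>snd t. x $ j)}" by simp
  also have "\<dots> \<in> sets ?P"
  proof (intro sets.sets_Collect_countable_Ex sets_Collect_compact_feasible C' T)
    fix t assume t: "t \<in> ?T"
    show "continuous_on UNIV (\<lambda>x :: real ^ 'n. \<Sum>j\<in>snd t. x $ j)"
      by (intro continuous_on_sum continuous_on_component continuous_on_id)
    have [measurable]: "(\<lambda>\<xi>. \<xi> (fst t)) \<in> measurable ?P M" "u (snd t) \<in> borel_measurable M"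
      using t u by (auto intro!: measurable_component_singleton)
    show "(\<lambda>\<xi>. u (snd t) (\<xi> (fst t))) \<in> borel_measurable ?P" by measurable
  qed
  finally show ?thesis .
qed

subsection \<open>Private sampling\<close>

lemma reduced_coreD:
  "x \<in> reduced_core u uN J \<xi> \<Longrightarrow> (i, k) \<in> J \<Longrightarrow> S \<in> coalitions \<Longrightarrow> i \<in> S \<Longrightarrow> u S (\<xi> (i, k)) \<le> (\<Sum>j\<in>S. x $ j)"
  unfolding reduced_core_def by blast

lemma reduced_core_cong:
  "(\<And>l. l \<in> J \<Longrightarrow> \<xi> l = \<xi>' l) \<Longrightarrow> reduced_core u uN J \<xi> = reduced_core u uN J \<xi>'"
  by (force simp: reduced_core_def)

lemma borel_measurable_coordinate_sum [measurable]:
  "(\<lambda>x :: real ^ 'n::finite. \<Sum>j\<in>S. x $ j) \<in> borel_measurable borel"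
  by (intro borel_measurable_continuous_onI continuous_on_sum continuous_on_component continuous_on_id)

text \<open>The list \<open>gs\<close> holds the objective together with the tie-break functions.
  Uniqueness is imposed at every multi-sample because it is applied below to samples with
  repetitions, which may form a null set.\<close>

locale private_sampling = prob_space M for M :: "'a measure" +
  fixes u :: "'n::finite set \<Rightarrow> 'a \<Rightarrow> real" and uN :: real and K :: "'n \<Rightarrow> nat"
    and gs :: "(real ^ 'n \<Rightarrow> real) list" and xstar :: "('n \<times> nat \<Rightarrow> 'a) \<Rightarrow> real ^ 'n"
  assumes u_measurable: "S \<in> coalitions \<Longrightarrow> u S \<in> borel_measurable M"
    and K_pos: "K i \<ge> 1"
    and gs_convex: "g \<in> set gs \<Longrightarrow> convex_on UNIV g"
    and xstar_unique: "\<xi> \<in> space (multisample M K) \<Longrightarrow>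
      minimisers gs (scenario_core u uN K \<xi>) = {xstar \<xi>}"
begin

lemma minimisers_core:
  "\<xi> \<in> space (multisample M K) \<Longrightarrow> minimisers gs (reduced_core u uN (labels K) \<xi>) = {xstar \<xi>}"
  using xstar_unique[of \<xi>] unfolding scenario_core_eq_reduced_core[OF K_pos] .

lemma xstar_in_core:
  "\<xi> \<in> space (multisample M K) \<Longrightarrow> xstar \<xi> \<in> reduced_core u uN (labels K) \<xi>"
  using minimisers_core[of \<xi>] minimisers_subset[of gs "reduced_core u uN (labels K) \<xi>"] by simp

lemma prob_space_multisample: "prob_space (multisample M K)"
  unfolding multisample_def by (intro prob_space_PiM) (rule prob_space_axioms)

text \<open>A singleton misses the closed complement of an open set exactly when its point lies in
  the open set, so preimages under \<open>xstar\<close> are complements of hitting events.\<close>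

lemma xstar_measurable [measurable]: "xstar \<in> borel_measurable (multisample M K)"
proof (rule borel_measurableI)
  fix O' :: "(real ^ 'n) set" assume "open O'"
  have "{\<xi> \<in> space (multisample M K). minimisers gs (reduced_core u uN (labels K) \<xi>) \<inter> - O' \<noteq> {}}
      \<in> sets (multisample M K)"
  proof (rule sets_Collect_minimisers_hit)
    fix \<xi> assume "\<xi> \<in> space (multisample M K)"
    then show "reduced_core u uN (labels K) \<xi> \<noteq> {}" using xstar_in_core by blast
    have "\<exists>k. (i, k) \<in> labels K" for i using K_pos[of i] by (auto simp: labels_def)
    then show "compact (reduced_core u uN (labels K) \<xi>)" by (rule compact_reduced_core)
  next
    fix C :: "(real ^ 'n) set" assume "closed C"
    then show "{\<xi> \<in> space (multisample M K). reduced_core u uN (labels K) \<xi> \<inter> C \<noteq> {}}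
        \<in> sets (multisample M K)"
      unfolding multisample_def by (intro sets_Collect_reduced_core_hit u_measurable finite_labels)
  next
    fix g assume "g \<in> set gs"
    then show "continuous_on UNIV g" using gs_convex convex_on_continuous open_UNIV by blast
  qed (use \<open>open O'\<close> in auto)
  also have "{\<xi> \<in> space (multisample M K). minimisers gs (reduced_core u uN (labels K) \<xi>) \<inter> - O' \<noteq> {}}
      = space (multisample M K) - (xstar -` O' \<inter> space (multisample M K))"
    using minimisers_core by auto
  finally have "space (multisample M K) - (space (multisample M K) - (xstar -` O' \<inter> space (multisample M K)))
      \<in> sets (multisample M K)" by (rule sets.compl_sets)
  then show "xstar -` O' \<inter> space (multisample M K) \<in> sets (multisample M K)"
    by (simp add: Diff_Diff_Int Int_commute Int_left_commute)
qed

section \<open>Violation sets and replicated samples\<close>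

definition viol :: "'n set set \<Rightarrow> real ^ 'n \<Rightarrow> 'a set" where
  "viol T x = {z \<in> space M. \<exists>S\<in>T. (\<Sum>j\<in>S. x $ j) < u S z}"

text \<open>Joint measurability is needed because both the allocation and the tested sample are
  random; the sections and their probabilities are derived from it.\<close>

lemma measurable_viol_pair:
  assumes "T \<subseteq> coalitions"
  shows "{p \<in> space (borel \<Otimes>\<^sub>M M). snd p \<in> viol T (fst p)} \<in> sets (borel \<Otimes>\<^sub>M M)"
proof -
  have "{p \<in> space (borel \<Otimes>\<^sub>M M). snd p \<in> viol T (fst p)} =
      (\<Union>S\<in>T. {p \<in> space (borel \<Otimes>\<^sub>M M). (\<Sum>j\<in>S. fst p $ j) < u S (snd p)})"
    by (auto simp: viol_def space_pair_measure)
  also have "\<dots> \<in> sets (borel \<Otimes>\<^sub>M M)"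
  proof (intro sets.finite_UN)
    fix S assume "S \<in> T"
    then have [measurable]: "u S \<in> borel_measurable M" using assms u_measurable by auto
    show "{p \<in> space (borel \<Otimes>\<^sub>M M). (\<Sum>j\<in>S. fst p $ j) < u S (snd p)} \<in> sets (borel \<Otimes>\<^sub>M M)"
      by measurable
  qed simp
  finally show ?thesis .
qed

lemma sets_viol: "T \<subseteq> coalitions \<Longrightarrow> viol T x \<in> sets M"
proof -
  assume T: "T \<subseteq> coalitions"
  have "Pair x -` {p \<in> space (borel \<Otimes>\<^sub>M M). snd p \<in> viol T (fst p)} \<in> sets M"
    by (rule sets_Pair1[OF measurable_viol_pair[OF T]])
  also have "Pair x -` {p \<in> space (borel \<Otimes>\<^sub>M M). snd p \<in> viol T (fst p)} = viol T x"
    by (auto simp: viol_def space_pair_measure)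
  finally show ?thesis .
qed

lemma measurable_prob_viol:
  assumes T: "T \<subseteq> coalitions"
  shows "(\<lambda>x. prob (viol T x)) \<in> borel_measurable borel"
proof -
  have "(\<lambda>x. emeasure M (Pair x -` {p \<in> space (borel \<Otimes>\<^sub>M M). snd p \<in> viol T (fst p)})) \<in> borel_measurable borel"
    by (rule measurable_emeasure_Pair[OF measurable_viol_pair[OF T]])
  moreover have "Pair x -` {p \<in> space (borel \<Otimes>\<^sub>M M). snd p \<in> viol T (fst p)} = viol T x" for x
    by (auto simp: viol_def space_pair_measure)
  ultimately show ?thesis unfolding measure_def by simp
qed

text \<open>Replaces the samples of agent \<open>i\<close> outside \<open>J\<close> by copies of one sample in \<open>J\<close>. The result is
  again a multi-sample, so uniqueness of the minimiser carries over to the problem that drops them.\<close>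

definition replicate_samples :: "'n \<Rightarrow> nat set \<Rightarrow> ('n \<times> nat \<Rightarrow> 'a) \<Rightarrow> ('n \<times> nat \<Rightarrow> 'a)" where
  "replicate_samples i J \<xi> =
     (\<lambda>l\<in>labels K. if fst l = i \<and> snd l \<notin> J then \<xi> (i, Min J) else \<xi> l)"

lemma Min_label:
  assumes "J \<noteq> {}" "J \<subseteq> {1..K i}"
  shows "Min J \<in> J" "(i, Min J) \<in> labels K"
proof -
  show "Min J \<in> J" using assms finite_subset Min_in by blast
  then show "(i, Min J) \<in> labels K" using assms by (auto simp: labels_def)
qed

lemma measurable_replicate_samples [measurable]:
  assumes "J \<noteq> {}" "J \<subseteq> {1..K i}"
  shows "replicate_samples i J \<in> measurable (multisample M K) (multisample M K)"
  unfolding replicate_samples_def multisample_def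
proof (rule measurable_restrict)
  fix l assume l: "l \<in> labels K"
  show "(\<lambda>\<xi>. if fst l = i \<and> snd l \<notin> J then \<xi> (i, Min J) else \<xi> l) \<in> measurable (PiM (labels K) (\<lambda>_. M)) M"
    using l Min_label[OF assms]
    by (cases "fst l = i \<and> snd l \<notin> J") (auto intro: measurable_component_singleton)
qed

text \<open>The copies only repeat constraints of the sample \<open>(i, Min J)\<close>, which is
  retained on the right-hand side.\<close>

lemma reduced_core_replicate_samples:
  assumes "J \<noteq> {}" "J \<subseteq> {1..K i}"
  shows "reduced_core u uN (labels K) (replicate_samples i J \<xi>) =
    reduced_core u uN (labels K - {i} \<times> ({1..K i} - J)) \<xi>" (is "?L = ?R")
proof
  let ?B = "{i} \<times> ({1..K i} - J)"
  have "?L \<subseteq> reduced_core u uN (labels K - ?B) (replicate_samples i J \<xi>)"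
    by (rule reduced_core_antimono) auto
  also have "\<dots> = ?R"
    by (rule reduced_core_cong) (auto simp: replicate_samples_def labels_def)
  finally show "?L \<subseteq> ?R" .
  show "?R \<subseteq> ?L"
  proof
    fix x assume x: "x \<in> ?R"
    have "u S (replicate_samples i J \<xi> (j, k)) \<le> (\<Sum>m\<in>S. x $ m)"
      if jk: "(j, k) \<in> labels K" "S \<in> coalitions" "j \<in> S" for j k S
    proof (cases "j = i \<and> k \<notin> J")
      case True
      have "(i, Min J) \<in> labels K - ?B" using Min_label[of J i] assms by blast
      from reduced_coreD[OF x this jk(2)] show ?thesis using jk True by (simp add: replicate_samples_def)
    next
      case False
      then have "(j, k) \<in> labels K - ?B" using jk by auto
      from reduced_coreD[OF x this jk(2,3)] show ?thesis using jk False by (auto simp: replicate_samples_def)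
    qed
    then show "x \<in> ?L" using x by (auto simp: reduced_core_def)
  qed
qed

section \<open>Reduction to at most N samples of one agent\<close>

text \<open>The points better than the optimum and feasible for the other agents' samples in
  \<open>I\<close> form a convex set \<open>?A\<close> that misses the intersection of the sets
  \<open>?H k\<close>. The optimum lies in every \<open>?H k\<close>, so at most
  \<open>CARD('n)\<close> of them already exclude all better points.\<close>

lemma small_compression:
  assumes xi: "\<xi> \<in> space (multisample M K)" and I: "I \<subseteq> labels K"
    and min: "minimisers gs (reduced_core u uN I \<xi>) = {xstar \<xi>}"
    and ne: "{k. (i, k) \<in> I} \<noteq> {}"
  obtains J where "J \<subseteq> {k. (i, k) \<in> I}" "J \<noteq> {}" "card J \<le> CARD('n)"
    "xstar (replicate_samples i J \<xi>) = xstar \<xi>"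
proof -
  let ?Q = "{k. (i, k) \<in> I}"
  let ?I' = "{p \<in> I. fst p \<noteq> i}"
  let ?H = "\<lambda>k. reduced_core u uN {(i, k)} \<xi>"
  let ?A = "{y. lexless gs y (xstar \<xi>)} \<inter> reduced_core u uN ?I' \<xi>"
  have Q: "?Q \<subseteq> {1..K i}" using I by (auto simp: labels_def)
  then have finQ: "finite ?Q" using finite_subset by blast
  have core: "xstar \<xi> \<in> reduced_core u uN (labels K) \<xi>" using xstar_in_core xi by blast
  have "?A \<inter> (\<Inter>k\<in>?Q. ?H k) \<subseteq> {y. lexless gs y (xstar \<xi>)} \<inter> reduced_core u uN I \<xi>"
    by (fastforce simp: reduced_core_def)
  also have "\<dots> = {}" using min by (auto simp: minimisers_lexless)
  finally have empty: "?A \<inter> (\<Inter>k\<in>?Q. ?H k) = {}" by simp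
  have convA: "convex ?A"
    using gs_convex by (intro convex_Int convex_lexless convex_reduced_core)
  have "xstar \<xi> \<in> ?H k" if "k \<in> ?Q" for k
    using core reduced_core_antimono[of "{(i, k)}" "labels K" u uN \<xi>] that I by auto
  then obtain J0 where J0: "J0 \<subseteq> ?Q" "card J0 \<le> DIM(real ^ 'n)" "?A \<inter> (\<Inter>k\<in>J0. ?H k) = {}"
    using Helly_common_point[OF finQ convA convex_reduced_core _ empty] by blast
  obtain k0 where k0: "k0 \<in> ?Q" using ne by auto
  \<comment> \<open>Replication needs at least one retained sample; as there is at least one agent,
    the size bound survives.\<close>
  define J where "J = (if J0 = {} then {k0} else J0)"
  have J: "J0 \<subseteq> J" "J \<subseteq> ?Q" "J \<noteq> {}" "card J \<le> CARD('n)"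
    using J0 k0 by (auto simp: J_def Suc_leI)
  have JK: "J \<subseteq> {1..K i}" using J Q by blast
  let ?R = "reduced_core u uN (labels K - {i} \<times> ({1..K i} - J)) \<xi>"
  have "xstar \<xi> \<in> ?R"
    using core reduced_core_antimono[of "labels K - {i} \<times> ({1..K i} - J)" "labels K" u uN \<xi>] by blast
  \<comment> \<open>The other samples may be put back, since the optimum satisfies them and extra
    constraints create no better point.\<close>
  moreover have "\<not> lexless gs y (xstar \<xi>)" if y: "y \<in> ?R" for y
  proof
    assume less: "lexless gs y (xstar \<xi>)"
    have "?I' \<subseteq> labels K - {i} \<times> ({1..K i} - J)" using I by auto
    then have "y \<in> reduced_core u uN ?I' \<xi>" using y reduced_core_antimono by blast
    moreover have "y \<in> ?H k" if "k \<in> J0" for k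
    proof -
      have "{(i, k)} \<subseteq> labels K - {i} \<times> ({1..K i} - J)" using that J I by blast
      then show ?thesis using y reduced_core_antimono by blast
    qed
    ultimately show False using less J0 by blast
  qed
  ultimately have "xstar \<xi> \<in> minimisers gs ?R" by (simp add: minimisers_lexless)
  then have "xstar \<xi> \<in> minimisers gs (reduced_core u uN (labels K) (replicate_samples i J \<xi>))"
    using reduced_core_replicate_samples[OF J(3) JK] by simp
  moreover have "replicate_samples i J \<xi> \<in> space (multisample M K)"
    using measurable_space[OF measurable_replicate_samples[OF J(3) JK] xi] .
  ultimately have "xstar (replicate_samples i J \<xi>) = xstar \<xi>" using minimisers_core by simp
  then show ?thesis using that J by blast
qed

lemma labels_split:
  assumes "J \<subseteq> {1..K i}"
  shows "labels K = (labels K - {i} \<times> ({1..K i} - J)) \<union> {i} \<times> ({1..K i} - J)"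
  by (auto simp: labels_def)

section \<open>Violation events for a fixed set of retained samples\<close>

text \<open>The replicated allocation depends only on the coordinates in \<open>?A\<close>. Once
  these are fixed, so is its violation set, and the remaining \<open>K i - card J\<close> samples of
  agent \<open>i\<close> avoid it independently.\<close>

lemma replicated_event:
  fixes e :: real
  assumes J: "J \<noteq> {}" "J \<subseteq> {1..K i}" and T: "T \<subseteq> coalitions" and e: "e \<le> 1"
  defines "E \<equiv> {\<xi> \<in> space (multisample M K). e < prob (viol T (xstar (replicate_samples i J \<xi>))) \<and>
    (\<forall>k\<in>{1..K i} - J. \<xi> (i, k) \<notin> viol T (xstar (replicate_samples i J \<xi>)))}"
  shows "E \<in> sets (multisample M K)" "measure (multisample M K) E \<le> (1 - e) ^ (K i - card J)"
proof -
  let ?r = "replicate_samples i J"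
  let ?B = "{i} \<times> ({1..K i} - J)"
  let ?A = "labels K - ?B"
  note [measurable] = measurable_replicate_samples[OF J]
  have "{\<xi> \<in> space (multisample M K). \<xi> (i, k) \<notin> viol T (xstar (?r \<xi>))} \<in> sets (multisample M K)"
    if k: "k \<in> {1..K i} - J" for k
  proof -
    have [measurable]: "(\<lambda>\<xi>. \<xi> (i, k)) \<in> measurable (multisample M K) M"
      using k unfolding multisample_def by (intro measurable_component_singleton) (auto simp: labels_def)
    have "(\<lambda>\<xi>. (xstar (?r \<xi>), \<xi> (i, k))) \<in> measurable (multisample M K) (borel \<Otimes>\<^sub>M M)"
      by measurable
    from measurable_sets[OF this measurable_viol_pair[OF T]]
    have "{\<xi> \<in> space (multisample M K). \<xi> (i, k) \<in> viol T (xstar (?r \<xi>))} \<in> sets (multisample M K)"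
      by (simp add: vimage_def Int_def space_pair_measure viol_def conj_commute cong: conj_cong)
    then show ?thesis by (rule sets.sets_Collect_neg)
  qed
  then have avoid: "{\<xi> \<in> space (multisample M K). \<forall>k\<in>{1..K i} - J. \<xi> (i, k) \<notin> viol T (xstar (?r \<xi>))}
      \<in> sets (multisample M K)"
    by (intro sets.sets_Collect_countable_All') auto
  have "(\<lambda>\<xi>. prob (viol T (xstar (?r \<xi>)))) \<in> borel_measurable (multisample M K)"
    by (rule measurable_compose[OF _ measurable_prob_viol[OF T]]) measurable
  then have less: "{\<xi> \<in> space (multisample M K). e < prob (viol T (xstar (?r \<xi>)))} \<in> sets (multisample M K)"
    by (rule borel_measurable_less[OF borel_measurable_const])
  have "E = {\<xi> \<in> space (multisample M K). e < prob (viol T (xstar (?r \<xi>)))} \<inter>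
      {\<xi> \<in> space (multisample M K). \<forall>k\<in>{1..K i} - J. \<xi> (i, k) \<notin> viol T (xstar (?r \<xi>))}"
    unfolding E_def by blast
  then show E: "E \<in> sets (multisample M K)" using less avoid by simp
  have fin: "finite ?A" "finite ?B" "?A \<inter> ?B = {}" using finite_labels by auto
  have eqL: "labels K = ?A \<union> ?B" by (rule labels_split[OF J(2)])
  have "measure (PiM (?A \<union> ?B) (\<lambda>_. M)) E \<le> (1 - e) ^ card ?B"
  proof (rule PiM_split_bound[OF fin])
    show "E \<in> sets (PiM (?A \<union> ?B) (\<lambda>_. M))" using E unfolding multisample_def eqL[symmetric] .
    have "\<exists>V\<in>sets M. e \<le> prob V \<and>
      (AE \<zeta> in PiM ?B (\<lambda>_. M). merge ?A ?B (\<eta>, \<zeta>) \<in> E \<longrightarrow> (\<forall>l\<in>?B. \<zeta> l \<notin> V))" for \<eta>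
    proof -
      \<comment> \<open>The coordinates from \<open>?B\<close> are overwritten by the
        replication.\<close>
      have r: "?r (merge ?A ?B (\<eta>, \<zeta>)) = ?r \<eta>" for \<zeta>
        using Min_label[OF J] by (auto simp: replicate_samples_def fun_eq_iff merge_def labels_def)
      show ?thesis
      proof (cases "e < prob (viol T (xstar (?r \<eta>)))")
        case True
        have "\<zeta> l \<notin> viol T (xstar (?r \<eta>))" if "merge ?A ?B (\<eta>, \<zeta>) \<in> E" "l \<in> ?B" for \<zeta> l
        proof -
          obtain k where k: "l = (i, k)" "k \<in> {1..K i} - J" using \<open>l \<in> ?B\<close> by auto
          have "merge ?A ?B (\<eta>, \<zeta>) (i, k) \<notin> viol T (xstar (?r \<eta>))"
            using that(1) k(2) unfolding E_def mem_Collect_eq r by blast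
          then show ?thesis using k by (simp add: merge_def)
        qed
        then show ?thesis using True sets_viol[OF T] by (intro bexI[of _ "viol T (xstar (?r \<eta>))"]) auto
      next
        case False
        then have "merge ?A ?B (\<eta>, \<zeta>) \<notin> E" for \<zeta> unfolding E_def mem_Collect_eq r by blast
        \<comment> \<open>The section of \<open>E\<close> is empty here, so the implication is
          vacuous and any set of probability at least \<open>e\<close> serves.\<close>
        then show ?thesis using e prob_space by (intro bexI[of _ "space M"]) auto
      qed
    qed
    then show "AE \<eta> in PiM ?A (\<lambda>_. M). \<exists>V\<in>sets M. e \<le> prob V \<and>
      (AE \<zeta> in PiM ?B (\<lambda>_. M). merge ?A ?B (\<eta>, \<zeta>) \<in> E \<longrightarrow> (\<forall>l\<in>?B. \<zeta> l \<notin> V))" by simp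
  qed
  moreover have "card ?B = K i - card J"
    using J by (simp add: card_cartesian_product card_Diff_subset finite_subset)
  ultimately show "measure (multisample M K) E \<le> (1 - e) ^ (K i - card J)"
    unfolding multisample_def by (metis eqL)
qed

text \<open>With no sample of agent \<open>i\<close> left there is nothing to replicate. Instead, the compression property
  itself makes the minimiser of the problem without agent \<open>i\<close> unique, and that problem depends only
  on the samples of the other agents.\<close>

lemma unsampled_event:
  assumes T: "T \<subseteq> coalitions" and e: "e \<le> 1" and E: "E \<in> sets (multisample M K)"
    and AE: "AE \<xi> in multisample M K. \<xi> \<in> E \<longrightarrow> e < prob (viol T (xstar \<xi>)) \<and>
      (\<forall>k\<in>{1..K i}. \<xi> (i, k) \<notin> viol T (xstar \<xi>)) \<and>
      (\<exists>I\<subseteq>labels K - {i} \<times> {1..K i}. minimisers gs (reduced_core u uN I \<xi>) = {xstar \<xi>})"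
  shows "measure (multisample M K) E \<le> (1 - e) ^ K i"
proof -
  let ?B = "{i} \<times> {1..K i}"
  let ?A = "labels K - ?B"
  have fin: "finite ?A" "finite ?B" "?A \<inter> ?B = {}" using finite_labels by auto
  have eqL: "labels K = ?A \<union> ?B" using labels_split[of "{}" i] by simp
  \<comment> \<open>The set \<open>I\<close> varies with \<open>\<xi>\<close>; it is enlarged to the
    fixed label set \<open>?A\<close>. This keeps the minimiser, as \<open>xstar \<xi>\<close>
    satisfies the added constraints.\<close>
  let ?P = "\<lambda>\<xi>. \<xi> \<in> E \<longrightarrow> e < prob (viol T (xstar \<xi>)) \<and>
      (\<forall>k\<in>{1..K i}. \<xi> (i, k) \<notin> viol T (xstar \<xi>)) \<and> minimisers gs (reduced_core u uN ?A \<xi>) = {xstar \<xi>}"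
  have "AE \<xi> in multisample M K. ?P \<xi>"
    using AE AE_space
  proof eventually_elim
    case (elim \<xi>)
    show ?case
    proof
      assume "\<xi> \<in> E"
      then obtain I where I: "I \<subseteq> ?A" "minimisers gs (reduced_core u uN I \<xi>) = {xstar \<xi>}"
        and *: "e < prob (viol T (xstar \<xi>))" "\<forall>k\<in>{1..K i}. \<xi> (i, k) \<notin> viol T (xstar \<xi>)"
        using elim by blast
      have "xstar \<xi> \<in> reduced_core u uN ?A \<xi>"
        using xstar_in_core[OF elim(2)] reduced_core_antimono[of ?A "labels K" u uN \<xi>] by blast
      then have "minimisers gs (reduced_core u uN ?A \<xi>) = {xstar \<xi>}"
        using minimisers_mono[OF reduced_core_antimono[OF I(1)], of gs u uN \<xi>] I(2) by simp
      with * show "e < prob (viol T (xstar \<xi>)) \<and> (\<forall>k\<in>{1..K i}. \<xi> (i, k) \<notin> viol T (xstar \<xi>)) \<and>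
        minimisers gs (reduced_core u uN ?A \<xi>) = {xstar \<xi>}" by blast
    qed
  qed
  then have "AE \<xi> in PiM (?A \<union> ?B) (\<lambda>_. M). ?P \<xi>" unfolding multisample_def eqL[symmetric] .
  from AE_PiM_merge[OF fin this]
  have "AE \<eta> in PiM ?A (\<lambda>_. M). AE \<zeta> in PiM ?B (\<lambda>_. M). ?P (merge ?A ?B (\<eta>, \<zeta>))" .
  then have "AE \<eta> in PiM ?A (\<lambda>_. M). \<exists>V\<in>sets M. e \<le> prob V \<and>
      (AE \<zeta> in PiM ?B (\<lambda>_. M). merge ?A ?B (\<eta>, \<zeta>) \<in> E \<longrightarrow> (\<forall>l\<in>?B. \<zeta> l \<notin> V))"
  proof eventually_elim
    case (elim \<eta>)
    have core: "reduced_core u uN ?A (merge ?A ?B (\<eta>, \<zeta>)) = reduced_core u uN ?A \<eta>" for \<zeta>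
      by (rule reduced_core_cong) (auto simp: merge_def)
    show ?case
    \<comment> \<open>The reduced problem does not see \<open>\<zeta>\<close>, so one point
      \<open>x\<close> equals \<open>xstar\<close> on almost the whole section of \<open>E\<close>.
      Otherwise almost every \<open>\<zeta>\<close> lies outside this section.\<close>
    proof (cases "\<exists>x. minimisers gs (reduced_core u uN ?A \<eta>) = {x} \<and> e < prob (viol T x)")
      case True
      then obtain x where x: "minimisers gs (reduced_core u uN ?A \<eta>) = {x}" "e < prob (viol T x)" by blast
      have "AE \<zeta> in PiM ?B (\<lambda>_. M). merge ?A ?B (\<eta>, \<zeta>) \<in> E \<longrightarrow> (\<forall>l\<in>?B. \<zeta> l \<notin> viol T x)"
        using elim
      proof eventually_elim
        case (elim \<zeta>)
        show ?case
        proof (intro impI ballI)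
          fix l assume "merge ?A ?B (\<eta>, \<zeta>) \<in> E" "l \<in> ?B"
          moreover from this obtain k where k: "l = (i, k)" "k \<in> {1..K i}" by auto
          ultimately have "merge ?A ?B (\<eta>, \<zeta>) (i, k) \<notin> viol T x"
            using elim x(1) unfolding core by (metis singleton_inject)
          then show "\<zeta> l \<notin> viol T x" using k by (simp add: merge_def)
        qed
      qed
      then show ?thesis using x sets_viol[OF T] by (intro bexI[of _ "viol T x"]) auto
    next
      case False
      have "AE \<zeta> in PiM ?B (\<lambda>_. M). merge ?A ?B (\<eta>, \<zeta>) \<in> E \<longrightarrow> (\<forall>l\<in>?B. \<zeta> l \<notin> space M)"
        using elim by eventually_elim (use False core in auto)
      then show ?thesis using e prob_space by (intro bexI[of _ "space M"]) auto
    qed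
  qed
  moreover have "E \<in> sets (PiM (?A \<union> ?B) (\<lambda>_. M))" using E unfolding multisample_def eqL[symmetric] .
  ultimately have "measure (PiM (?A \<union> ?B) (\<lambda>_. M)) E \<le> (1 - e) ^ card ?B"
    by (intro PiM_split_bound[OF fin])
  then show ?thesis unfolding multisample_def by (metis eqL card_cartesian_product_singleton card_atLeastAtMost diff_Suc_1)
qed

text \<open>A sample of agent \<open>i\<close> constrains only coalitions that contain
  \<open>i\<close>, whence the restriction of the violation set.\<close>

lemma samples_not_violating:
  assumes xi: "\<xi> \<in> space (multisample M K)" and "k \<in> {1..K i}"
  shows "\<xi> (i, k) \<notin> viol {S \<in> coalitions. i \<in> S} (xstar \<xi>)"
proof -
  have "(i, k) \<in> labels K" using assms by (auto simp: labels_def)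
  from reduced_coreD[OF xstar_in_core[OF xi] this] show ?thesis by (force simp: viol_def)
qed

lemma measurable_prob_viol_xstar:
  assumes "T \<subseteq> coalitions"
  shows "(\<lambda>\<xi>. prob (viol T (xstar \<xi>))) \<in> borel_measurable (multisample M K)"
  by (rule measurable_compose[OF xstar_measurable measurable_prob_viol[OF assms]])

section \<open>The bound for one agent\<close>

text \<open>Up to a null set, \<open>F\<close> is covered by \<open>E0\<close>, where no sample of
  agent \<open>i\<close> is selected, and the events \<open>E J\<close>. The latter do not mention
  \<open>I\<close>, so their measurability comes from that of \<open>xstar\<close> and
  \<open>replicate_samples\<close>. Each size from 0 to \<open>CARD('n)\<close> contributes at most
  \<open>b / (N + 1)\<close>.\<close>

lemma agent_violation_bound:
  fixes I :: "('n \<times> nat \<Rightarrow> 'a) \<Rightarrow> ('n \<times> nat) set" and b :: real and i :: 'n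
  assumes comp: "compression_set M u uN K gs xstar I"
    and card_meas: "agent_card I i \<in> measurable (multisample M K) (count_space UNIV)"
    and b: "0 < b" "b \<le> real CARD('n) + 1"
  defines "F \<equiv> {\<xi> \<in> space (multisample M K). eps CARD('n) b (K i) (agent_card I i \<xi>) <
    prob (viol {S \<in> coalitions. i \<in> S} (xstar \<xi>))}"
  shows "F \<in> sets (multisample M K)" "measure (multisample M K) F \<le> b"
proof -
  interpret P: prob_space "multisample M K" by (rule prob_space_multisample)
  let ?T = "{S \<in> coalitions. i \<in> S}"
  let ?N = "CARD('n)"
  let ?e = "eps ?N b (K i)"
  have T: "?T \<subseteq> coalitions" by auto
  have e1: "?e s \<le> 1" for s using b by (intro eps_le_1)
  have "(\<lambda>\<xi>. ?e (agent_card I i \<xi>)) \<in> borel_measurable (multisample M K)"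
    by (rule measurable_compose[OF card_meas]) simp
  then show F: "F \<in> sets (multisample M K)"
    unfolding F_def using measurable_prob_viol_xstar[OF T] by (rule borel_measurable_less)
  define E0 where "E0 = F \<inter> (agent_card I i -` {0} \<inter> space (multisample M K))"
  have E0: "E0 \<in> sets (multisample M K)"
    unfolding E0_def using F measurable_sets[OF card_meas, of "{0}"] by auto
  \<comment> \<open>Size zero is covered by \<open>E0\<close>; size \<open>K i\<close> cannot occur
    on \<open>F\<close>, because there \<open>eps\<close> equals 1.\<close>
  define \<J> where "\<J> = {J. J \<subseteq> {1..K i} \<and> J \<noteq> {} \<and> card J \<le> ?N \<and> card J < K i}"
  have fin\<J>: "finite \<J>" unfolding \<J>_def by (rule finite_subset[of _ "Pow {1..K i}"]) auto
  define E where "E J = {\<xi> \<in> space (multisample M K).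
      ?e (card J) < prob (viol ?T (xstar (replicate_samples i J \<xi>))) \<and>
      (\<forall>k\<in>{1..K i} - J. \<xi> (i, k) \<notin> viol ?T (xstar (replicate_samples i J \<xi>)))}" for J
  have E: "E J \<in> sets (multisample M K)" "P.prob (E J) \<le> (1 - ?e (card J)) ^ (K i - card J)"
    if "J \<in> \<J>" for J
    using replicated_event[of J i ?T "?e (card J)"] that T e1 unfolding E_def \<J>_def by auto
  have I_labels: "I \<xi> \<subseteq> labels K" if "\<xi> \<in> space (multisample M K)" for \<xi>
    using comp that by (auto simp: compression_set_def)
  have good: "AE \<xi> in multisample M K. minimisers gs (reduced_core u uN (I \<xi>) \<xi>) = {xstar \<xi>}"
    using comp by (simp add: compression_set_def)
  have fin_I: "finite {k. (i, k) \<in> I \<xi>}" "{k. (i, k) \<in> I \<xi>} \<subseteq> {1..K i}"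
    if "\<xi> \<in> space (multisample M K)" for \<xi>
  proof -
    show "{k. (i, k) \<in> I \<xi>} \<subseteq> {1..K i}" using I_labels[OF that] by (auto simp: labels_def)
    then show "finite {k. (i, k) \<in> I \<xi>}" by (rule finite_subset) simp
  qed
  have "AE \<xi> in multisample M K. \<xi> \<in> F \<longrightarrow> \<xi> \<in> E0 \<union> (\<Union>J\<in>\<J>. E J)"
    using good AE_space
  proof eventually_elim
    case (elim \<xi>)
    let ?Q = "{k. (i, k) \<in> I \<xi>}"
    show ?case
    proof
      assume xF: "\<xi> \<in> F"
      then have less: "?e (card ?Q) < prob (viol ?T (xstar \<xi>))"
        by (simp add: F_def agent_card_def)
      show "\<xi> \<in> E0 \<union> (\<Union>J\<in>\<J>. E J)"
      proof (cases "?Q = {}")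
        case True
        then show ?thesis using xF elim by (simp add: E0_def agent_card_def)
      next
        case False
        obtain J where J: "J \<subseteq> ?Q" "J \<noteq> {}" "card J \<le> ?N" "xstar (replicate_samples i J \<xi>) = xstar \<xi>"
          using small_compression[OF elim(2) I_labels[OF elim(2)] elim(1) False] .
        have leQ: "card J \<le> card ?Q" using J fin_I[OF elim(2)] by (intro card_mono)
        have leK: "card ?Q \<le> K i" using card_mono[OF _ fin_I(2)[OF elim(2)]] by simp
        have "card ?Q \<noteq> K i"
        proof
          assume "card ?Q = K i"
          then have "1 < prob (viol ?T (xstar \<xi>))" using less by (simp add: eps_def)
          then show False using prob_le_1 not_less by blast
        qed
        then have "J \<in> \<J>" using J leQ leK fin_I[OF elim(2)] by (auto simp: \<J>_def)
        moreover have "?e (card J) < prob (viol ?T (xstar \<xi>))"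
          using eps_mono[OF b leQ leK] less by simp
        then have "\<xi> \<in> E J"
          using elim(2) samples_not_violating[OF elim(2)] J(4) by (simp add: E_def)
        ultimately show ?thesis by blast
      qed
    qed
  qed
  then have "P.prob F \<le> P.prob (E0 \<union> (\<Union>J\<in>\<J>. E J))"
    using E0 E fin\<J> by (intro P.finite_measure_mono_AE) auto
  also have "\<dots> \<le> P.prob E0 + P.prob (\<Union>J\<in>\<J>. E J)"
    using E0 E fin\<J> by (intro measure_Un_le) auto
  also have "\<dots> \<le> P.prob E0 + (\<Sum>J\<in>\<J>. P.prob (E J))"
    using E fin\<J> by (intro add_left_mono P.finite_measure_subadditive_finite) auto
  also have "\<dots> \<le> b / (real ?N + 1) + (\<Sum>J\<in>\<J>. (1 - ?e (card J)) ^ (K i - card J))"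
  proof (intro add_mono sum_mono E)
    have "P.prob E0 \<le> (1 - ?e 0) ^ K i"
    proof (rule unsampled_event[OF T e1 E0])
      show "AE \<xi> in multisample M K. \<xi> \<in> E0 \<longrightarrow> ?e 0 < prob (viol ?T (xstar \<xi>)) \<and>
        (\<forall>k\<in>{1..K i}. \<xi> (i, k) \<notin> viol ?T (xstar \<xi>)) \<and>
        (\<exists>I\<subseteq>labels K - {i} \<times> {1..K i}. minimisers gs (reduced_core u uN I \<xi>) = {xstar \<xi>})"
        using good AE_space
      proof eventually_elim
        case (elim \<xi>)
        show ?case
        proof
          assume x: "\<xi> \<in> E0"
          then have c: "agent_card I i \<xi> = 0" by (simp add: E0_def)
          \<comment> \<open>An infinite set also has \<open>card\<close> zero, so finiteness is
            used.\<close>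
          then have "{k. (i, k) \<in> I \<xi>} = {}" using fin_I[OF elim(2)] by (simp add: agent_card_def)
          then have "I \<xi> \<subseteq> labels K - {i} \<times> {1..K i}" using I_labels[OF elim(2)] by auto
          moreover have "?e 0 < prob (viol ?T (xstar \<xi>))" using x c by (simp add: E0_def F_def)
          ultimately show "?e 0 < prob (viol ?T (xstar \<xi>)) \<and>
            (\<forall>k\<in>{1..K i}. \<xi> (i, k) \<notin> viol ?T (xstar \<xi>)) \<and>
            (\<exists>I\<subseteq>labels K - {i} \<times> {1..K i}. minimisers gs (reduced_core u uN I \<xi>) = {xstar \<xi>})"
            using samples_not_violating[OF elim(2)] elim(1) by blast
        qed
      qed
    qed
    then show "P.prob E0 \<le> b / (real ?N + 1)"
      using eps_power[OF b(1), of 0 "K i" ?N] K_pos[of i] by simp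
  qed
  also have "(\<Sum>J\<in>\<J>. (1 - ?e (card J)) ^ (K i - card J)) \<le> real ?N * (b / (real ?N + 1))"
  proof -
    \<comment> \<open>The sum is grouped by cardinality: the sets of size \<open>s\<close> number
      \<open>K i choose s\<close>, and by \<open>eps_power\<close> each group sums to
      \<open>b / (N + 1)\<close>.\<close>
    let ?S = "{1..?N} \<inter> {..<K i}"
    have img: "card ` \<J> \<subseteq> ?S"
      by (auto simp: \<J>_def Suc_le_eq card_gt_0_iff dest: finite_subset[OF _ finite_atLeastAtMost])
    have "(\<Sum>J\<in>\<J>. (1 - ?e (card J)) ^ (K i - card J)) =
        (\<Sum>s\<in>?S. \<Sum>J\<in>{J \<in> \<J>. card J = s}. (1 - ?e (card J)) ^ (K i - card J))"
      by (rule sum.group[symmetric, OF fin\<J> _ img]) simp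
    also have "\<dots> = (\<Sum>s\<in>?S. b / (real ?N + 1))"
    proof (rule sum.cong[OF refl])
      fix s assume s: "s \<in> ?S"
      have "{J \<in> \<J>. card J = s} = {J. J \<subseteq> {1..K i} \<and> card J = s}"
        using s by (auto simp: \<J>_def)
      then have c: "card {J \<in> \<J>. card J = s} = K i choose s" using n_subsets[of "{1..K i}" s] by simp
      have "(\<Sum>J\<in>{J \<in> \<J>. card J = s}. (1 - ?e (card J)) ^ (K i - card J)) =
          (\<Sum>J\<in>{J \<in> \<J>. card J = s}. (1 - ?e s) ^ (K i - s))" by (rule sum.cong) auto
      also have "\<dots> = b / (real ?N + 1)" using eps_power[OF b(1), of s "K i" ?N] s c by simp
      finally show "(\<Sum>J\<in>{J \<in> \<J>. card J = s}. (1 - ?e (card J)) ^ (K i - card J)) = b / (real ?N + 1)" .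
    qed
    also have "\<dots> = real (card ?S) * (b / (real ?N + 1))" by simp
    also have "\<dots> \<le> real ?N * (b / (real ?N + 1))"
      using b card_mono[of "{1..?N}" ?S] by (intro mult_right_mono) auto
    finally show ?thesis .
  qed
  also have "b / (real ?N + 1) + real ?N * (b / (real ?N + 1)) = b"
  proof -
    have "real ?N + 1 \<noteq> 0" by (metis of_nat_Suc of_nat_neq_0 add.commute)
    then show ?thesis by (metis add.commute distrib_right mult_1 nonzero_mult_div_cancel_left times_divide_eq_right)
  qed
  finally show "P.prob F \<le> b" by simp
qed

end

section \<open>Union bound over the agents\<close>

theorem theorem4:
  fixes M :: "'a measure"
    and u :: "'n::finite set \<Rightarrow> 'a \<Rightarrow> real"
    and uN :: real
    and K :: "'n \<Rightarrow> nat"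
    and f :: "real ^ 'n \<Rightarrow> real"
    and ts :: "(real ^ 'n \<Rightarrow> real) list"
    and xstar :: "('n \<times> nat \<Rightarrow> 'a) \<Rightarrow> real ^ 'n"
    and I :: "('n \<times> nat \<Rightarrow> 'a) \<Rightarrow> ('n \<times> nat) set"
    and \<beta> :: real
    and b :: "'n \<Rightarrow> real"
  assumes "prob_space M"
    and "\<And>S. S \<in> coalitions \<Longrightarrow> u S \<in> borel_measurable M"
    and "\<And>i. K i \<ge> 1"
    and "\<And>\<xi>. \<xi> \<in> space (multisample M K) \<Longrightarrow> scenario_core u uN K \<xi> \<noteq> {}"
    and "0 < \<beta>" and "\<beta> < 1"
    and "\<And>i. b i > 0" and "(\<Sum>i\<in>UNIV. b i) = \<beta>"
    and "convex_on UNIV f"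
    and "\<And>t. t \<in> set ts \<Longrightarrow> convex_on UNIV t"
    and "\<And>\<xi>. \<xi> \<in> space (multisample M K) \<Longrightarrow>
           minimisers (f # ts) (scenario_core u uN K \<xi>) = {xstar \<xi>}"
    and "compression_set M u uN K (f # ts) xstar I"
    and "\<And>i. agent_card I i \<in> measurable (multisample M K) (count_space UNIV)"
  shows "measure (multisample M K)
           {\<xi> \<in> space (multisample M K).
              measure M {z \<in> space M. \<exists>S\<in>coalitions. (\<Sum>i\<in>S. xstar \<xi> $ i) < u S z}
                \<le> (\<Sum>i\<in>UNIV. eps CARD('n) (b i) (K i) (agent_card I i \<xi>))}
         \<ge> 1 - \<beta>"
proof -
  interpret private_sampling M u uN K "f # ts" xstar
    using assms(1) by (rule private_sampling.intro, unfold_locales) (use assms in auto)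
  interpret P: prob_space "multisample M K" by (rule prob_space_multisample)
  let ?T = "\<lambda>i. {S \<in> coalitions. i \<in> S}"
  let ?e = "\<lambda>\<xi> i. eps CARD('n) (b i) (K i) (agent_card I i \<xi>)"
  define F where "F i = {\<xi> \<in> space (multisample M K). ?e \<xi> i < prob (viol (?T i) (xstar \<xi>))}" for i
  let ?G = "{\<xi> \<in> space (multisample M K). prob (viol coalitions (xstar \<xi>)) \<le> (\<Sum>i\<in>UNIV. ?e \<xi> i)}"
  \<comment> \<open>Each \<open>b i\<close> is at most \<open>\<beta> < 1\<close>; the monotonicity
    of \<open>eps\<close> relies on such a bound.\<close>
  have "b i \<le> real CARD('n) + 1" for i
  proof -
    have "b i \<le> (\<Sum>i\<in>UNIV. b i)" using assms(7) by (intro member_le_sum) (auto intro: less_imp_le)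
    then show ?thesis using assms(6,8) by simp
  qed
  then have F: "F i \<in> sets (multisample M K)" "P.prob (F i) \<le> b i" for i
    using agent_violation_bound[OF assms(12,13,7)] unfolding F_def by auto
  have "(\<lambda>\<xi>. ?e \<xi> i) \<in> borel_measurable (multisample M K)" for i
    by (rule measurable_compose[OF assms(13)]) simp
  then have G: "?G \<in> sets (multisample M K)"
    by (intro borel_measurable_le measurable_prob_viol_xstar borel_measurable_sum) auto
  have "space (multisample M K) - ?G \<subseteq> (\<Union>i. F i)"
  proof
    fix \<xi> assume x: "\<xi> \<in> space (multisample M K) - ?G"
    \<comment> \<open>Coalitions are nonempty, so each violated one is charged to one of its
      members. If the total exceeds the sum of the thresholds, some agent exceeds its own.\<close>
    have "viol coalitions (xstar \<xi>) \<subseteq> (\<Union>i. viol (?T i) (xstar \<xi>))"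
      unfolding viol_def coalitions_def by blast
    then have "prob (viol coalitions (xstar \<xi>)) \<le> prob (\<Union>i. viol (?T i) (xstar \<xi>))"
      using sets_viol by (intro finite_measure_mono sets.finite_UN) auto
    also have "\<dots> \<le> (\<Sum>i\<in>UNIV. prob (viol (?T i) (xstar \<xi>)))"
      using sets_viol by (intro finite_measure_subadditive_finite) auto
    finally have "(\<Sum>i\<in>UNIV. ?e \<xi> i) < (\<Sum>i\<in>UNIV. prob (viol (?T i) (xstar \<xi>)))" using x by auto
    then obtain i where "?e \<xi> i < prob (viol (?T i) (xstar \<xi>))"
      by (meson not_le sum_mono)
    then show "\<xi> \<in> (\<Union>i. F i)" using x by (auto simp: F_def)
  qed
  then have "P.prob (space (multisample M K) - ?G) \<le> P.prob (\<Union>i. F i)"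
    using F by (intro P.finite_measure_mono sets.finite_UN) auto
  also have "\<dots> \<le> (\<Sum>i\<in>UNIV. P.prob (F i))"
    using F by (intro P.finite_measure_subadditive_finite) auto
  also have "\<dots> \<le> \<beta>" unfolding assms(8)[symmetric] by (intro sum_mono F)
  finally have "1 - P.prob ?G \<le> \<beta>" using P.prob_compl[OF G] by simp
  then show ?thesis unfolding viol_def by simp
qed

end
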